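(* Suppose that (P) and (D) admit a strictly complementary pair $z_{\star 0}=(x_{\star 0},y_{\star 0})$, put $s_{\star 0}=c+A^\top y_{\star 0}$, and suppose that the corresponding complementary faces, namely the face $\mathcal C_{s_{\star 0}}$ of $\mathcal K$ and the face $\mathcal C^*_{x_{\star 0}}$ of $\mathcal K^*$, admit quadratic facial violation. Fix $\beta>0$. Then there is an $r>0$ such that for any compact set $B\subset\mathbf E^2\times\mathbf F^2$ there are constants $\kappa_1,\kappa_2>0$ such that for all $(x,v,u,y)\in B$ (with $x,v\in\mathbf E$, $u,y\in\mathbf F$) and all $z_\star=(x_\star,y_\star)\in\mathcal Z_\star\cap B_r(z_{\star 0})$, $$L_\beta^P(x,u,y_\star)-L_\beta^P(x_\star,b,y_\star)\ge\kappa_1\operatorname{dist}^2((x,u),\mathcal P_\star),$$ $$L_\beta^D(y,v,x_\star)-L_\beta^D(y_\star,-A^\top y_\star,x_\star)\ge\kappa_2\operatorname{dist}^2((y,v),\mathcal D_\star),$$ where $\mathcal P_\star=\{(x,Ax):x\in\mathcal X_\star\}$ and $\mathcal D_\star=\{(y,-A^\top y):y\in\mathcal Y_\star\}$.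
   Context: $\mathbf E,\mathbf F$ are finite-dimensional Euclidean spaces; $A:\mathbf E\to\mathbf F$ is linear with adjoint $A^\top$; $b\in\mathbf F$, $c\in\mathbf E$; $\mathcal K\subset\mathbf E$ is a closed convex cone and $\mathcal K^*=\{s:\langle s,x\rangle\ge 0\ \forall x\in\mathcal K\}$. (P): $\min\{\langle c,x\rangle : Ax=b,\ x\in\mathcal K\}$. (D): $\max\{-\langle b,y\rangle : c+A^\top y=s,\ s\in\mathcal K^*,\ y\in\mathbf F\}$. $\mathcal X_\star$, $\mathcal Y_\star$ are the sets of optimal $x$ of (P) and optimal $y$ of (D); $\mathcal Z_\star=\mathcal X_\star\times\mathcal Y_\star$. $B_r(z)$ is the closed ball of radius $r$ around $z$; $\operatorname{dist}$ is Euclidean distance. Exposed faces: for $s\in\mathcal K^*$, $\mathcal C_s=\{x\in\mathcal K:\langle s,x\rangle=0\}$ (with defining vector $s$); for $x\in\mathcal K$, $\mathcal C^*_x=\{s\in\mathcal K^*:\langle s,x\rangle=0\}$ (with defining vector $x$). Strictly complementary pair: a pair $(x_\star,y_\star)$, with $x_\star$ optimal for (P), $y_\star$ optimal for (D), slack $s_\star=c+A^\top y_\star$, $\langle x_\star,s_\star\rangle=0$, $x_\star\in\operatorname{relint}(\mathcal C_{s_\star})$ and $s_\star\in\operatorname{relint}(\mathcal C^*_{x_\star})$. Quadratic facial violation (QFV): for $s\in\mathcal K^*$, the face $\mathcal C_s$ admits QFV relative to $s$ if for every compact set $B$ there is $\kappa>0$ with $\operatorname{dist}^2(x,\mathcal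 C_s)\le\kappa\langle s,x\rangle$ for all $x\in B\cap\mathcal K$. An exposed face admits QFV (without further qualification) if it admits QFV relative to every one of its defining vectors, i.e. relative to every $s'\in\mathcal K^*$ for which the face equals $\mathcal C_{s'}$. For faces $\mathcal C_x^*$ of $\mathcal K^*$ the same definitions are used with the roles of $\mathcal K$ and $\mathcal K^*$ exchanged. Augmented Lagrangians (values in $\mathbb R\cup\{+\infty\}$, $\iota$ denotes indicator functions): $L_\beta^P(x,u,y)=\langle c,x\rangle+\iota_{\mathcal K}(x)+\iota_{\{b\}}(u)+\langle y,Ax-u\rangle+\frac1{2\beta}\|Ax-u\|^2$, $L_\beta^D(y,v,x)=\langle b,y\rangle+\iota_{\mathcal K^*}(c-v)+\langle x,-A^\top y-v\rangle+\frac1{2\beta}\|A^\top y+v\|^2$. *)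

theory Defs
  imports "HOL-Analysis.Analysis"
begin

definition dual_cone :: "'a::real_inner set \<Rightarrow> 'a set" where
  "dual_cone K = {s. \<forall>x\<in>K. 0 \<le> s \<bullet> x}"

definition primal_optimal ::
    "('e::euclidean_space \<Rightarrow> 'f::euclidean_space) \<Rightarrow> 'f \<Rightarrow> 'e \<Rightarrow> 'e set \<Rightarrow> 'e set" where
  "primal_optimal A b c K = {x. is_arg_min (\<lambda>x. c \<bullet> x) (\<lambda>x. A x = b \<and> x \<in> K) x}"

definition dual_optimal ::
    "('e::euclidean_space \<Rightarrow> 'f::euclidean_space) \<Rightarrow> 'f \<Rightarrow> 'e \<Rightarrow> 'e set \<Rightarrow> 'f set" where
  "dual_optimal A b c K =
     {y. is_arg_max (\<lambda>y. - (b \<bullet> y)) (\<lambda>y. c + adjoint A y \<in> dual_cone K) y}"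

(* The face C_s of K is cone_face K s, for s in dual_cone K; the face C*_x of the dual cone is
   cone_face (dual_cone K) x, for x in K. *)
definition cone_face :: "'a::real_inner set \<Rightarrow> 'a \<Rightarrow> 'a set" where
  "cone_face K s = {x \<in> K. s \<bullet> x = 0}"

definition strictly_complementary ::
    "('e::euclidean_space \<Rightarrow> 'f::euclidean_space) \<Rightarrow> 'f \<Rightarrow> 'e \<Rightarrow> 'e set \<Rightarrow> 'e \<Rightarrow> 'f \<Rightarrow> bool" where
  "strictly_complementary A b c K x y \<longleftrightarrow>
     x \<in> primal_optimal A b c K \<and> y \<in> dual_optimal A b c K \<and>
     x \<bullet> (c + adjoint A y) = 0 \<and>
     x \<in> rel_interior (cone_face K (c + adjoint A y)) \<and>
     c + adjoint A y \<in> rel_interior (cone_face (dual_cone K) x)"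

definition qfv_relative :: "'a::euclidean_space set \<Rightarrow> 'a \<Rightarrow> bool" where
  "qfv_relative K s \<longleftrightarrow>
     (\<forall>B. compact B \<longrightarrow>
        (\<exists>\<kappa>>0. \<forall>x\<in>B \<inter> K. (infdist x (cone_face K s))\<^sup>2 \<le> \<kappa> * (s \<bullet> x)))"

(* S is the set from which the defining vectors of faces of K are taken: S = dual_cone K for faces
   of K itself.  For faces of dual_cone K the roles are exchanged: admits_qfv (dual_cone K) K. *)
definition admits_qfv :: "'a::euclidean_space set \<Rightarrow> 'a set \<Rightarrow> 'a set \<Rightarrow> bool" where
  "admits_qfv K S F \<longleftrightarrow> (\<forall>s\<in>S. F = cone_face K s \<longrightarrow> qfv_relative K s)"

definition indicator_fun :: "'a set \<Rightarrow> 'a \<Rightarrow> ereal" where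
  "indicator_fun S x = (if x \<in> S then 0 else \<infinity>)"

definition primal_lagrangian ::
    "('e::euclidean_space \<Rightarrow> 'f::euclidean_space) \<Rightarrow> 'f \<Rightarrow> 'e \<Rightarrow> 'e set \<Rightarrow> real
      \<Rightarrow> 'e \<Rightarrow> 'f \<Rightarrow> 'f \<Rightarrow> ereal" where
  "primal_lagrangian A b c K \<beta> x u y =
     ereal (c \<bullet> x) + indicator_fun K x + indicator_fun {b} u
     + ereal (y \<bullet> (A x - u)) + ereal (1 / (2 * \<beta>) * (norm (A x - u))\<^sup>2)"

definition dual_lagrangian ::
    "('e::euclidean_space \<Rightarrow> 'f::euclidean_space) \<Rightarrow> 'f \<Rightarrow> 'e \<Rightarrow> 'e set \<Rightarrow> real
      \<Rightarrow> 'f \<Rightarrow> 'e \<Rightarrow> 'e \<Rightarrow> ereal" where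
  "dual_lagrangian A b c K \<beta> y v x =
     ereal (b \<bullet> y) + indicator_fun (dual_cone K) (c - v)
     + ereal (x \<bullet> (- adjoint A y - v)) + ereal (1 / (2 * \<beta>) * (norm (adjoint A y + v))\<^sup>2)"

end

(* With s = c + A\<^sup>T y for a dual optimal y, the primal Lagrangian gap at a point x of K is
   <s, x> + |A x - b|^2 / (2 \<beta>).  Since s0 lies in the relative interior of C*_{x0}, a
   nearby optimal slack s satisfies 2 s - s0 \<in> K*, that is <s0, x> \<le> 2 <s, x> on K, so quadratic
   facial violation relative to s0 alone bounds dist^2(x, C_{s0}) uniformly in s.  The primal optimal
   set is the intersection of C_{s0} with the affine space A x = b, which meets the relative
   interior of C_{s0} in x0; hence the two sets are boundedly linearly regular.  The dual estimate
   is the same argument for the set F \<times> C*_{x0} and the equation s - A\<^sup>T y = c. *)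
theory Submission
  imports Defs
begin

section \<open>Error bounds for the intersection of a convex set with an affine space\<close>

text \<open>Project \<open>z\<close> to \<open>q\<close> in \<open>C\<close> and cancel the residual
  \<open>M q - b\<close> by moving \<open>q\<close> slightly towards a point \<open>q'\<close> of
  \<open>C\<close> whose residual points the opposite way. Such a \<open>q'\<close> exists near
  \<open>p\<close> because \<open>p\<close> is relatively interior; boundedness of \<open>Z\<close>
  keeps \<open>q'\<close> and \<open>q\<close> a bounded distance apart, so the move costs at most a
  constant times the residual.\<close>

lemma bounded_linear_regularity:
  fixes M :: "'a::euclidean_space \<Rightarrow> 'b::euclidean_space"
  assumes "closed C" and "convex C" and "linear M"
    and p: "p \<in> rel_interior C" and Mp: "M p = b" and "bounded Z"
  shows "\<exists>\<gamma>>0. \<forall>z\<in>Z. \<exists>z'\<in>C. M z' = b \<and> dist z z' \<le> \<gamma> * (infdist z C + norm (M z - b))"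
proof -
  obtain e where e: "e > 0" "cball p e \<inter> affine hull C \<subseteq> C" and pC: "p \<in> C"
    using p by (auto simp: mem_rel_interior_cball)
  \<comment> \<open>As \<open>p\<close> lies in \<open>C\<close>, \<open>S\<close> is the direction
    space of the affine hull of \<open>C\<close>. A linear right inverse \<open>g\<close> of
    \<open>M\<close> on \<open>S\<close> lifts residuals to directions in \<open>S\<close> of
    comparable norm.\<close>
  define S where "S = span ((\<lambda>x. x - p) ` C)"
  obtain g where g: "range g \<subseteq> S" "linear g" "\<And>v. v \<in> M ` S \<Longrightarrow> M (g v) = v"
    using linear_exists_right_inverse_on[OF \<open>linear M\<close>, of S] unfolding S_def by auto
  obtain Bg where Bg: "Bg > 0" "\<And>x. norm (g x) \<le> Bg * norm x"
    using linear_bounded_pos[OF g(2)] by blast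
  obtain BM where BM: "BM > 0" "\<And>x. norm (M x) \<le> BM * norm x"
    using linear_bounded_pos[OF \<open>linear M\<close>] by blast
  obtain R where R: "R > 0" "\<And>z. z \<in> Z \<Longrightarrow> dist p z \<le> R"
  proof -
    obtain R where "\<forall>z\<in>Z. dist p z \<le> R" using \<open>bounded Z\<close> bounded_any_center by blast
    then show ?thesis by (intro that[of "max R 1"]) auto
  qed
  define N where "N = Bg * (e + 2 * R) / e"
  have N: "N > 0" using Bg e R by (auto simp: N_def)
  have affS: "p + w \<in> affine hull C" if "w \<in> S" for w
    using that affine_hull_span_gen[of p C] hull_inc[OF pC, of affine]
    by (auto simp: S_def image_def)
  show ?thesis
  proof (intro exI[of _ "1 + N * BM + N"] conjI ballI)
    show "1 + N * BM + N > 0" using N BM by (simp add: add_pos_pos)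
    fix z assume z: "z \<in> Z"
    obtain q where q: "q \<in> C" "infdist z C = dist z q"
      using infdist_attains_inf[of C z] \<open>closed C\<close> pC by auto
    have dzq: "dist z q \<le> dist p z"
      using infdist_le[OF pC, of z] q by (simp add: dist_commute)
    have dpq: "dist p q \<le> 2 * R"
      using dist_triangle[of p q z] dzq R(2)[OF z] by linarith
    have qS: "q - p \<in> S" using q by (auto simp: S_def intro: span_base)
    \<comment> \<open>The vector \<open>q - p\<close> has the same image under \<open>M\<close>, but
      only the lift \<open>w\<close> has a norm bounded by the residual.\<close>
    define w where "w = g (M (q - p))"
    have wS: "w \<in> S" using g(1) by (auto simp: w_def)
    have Mw: "M w = M q - b"
      using g(3)[OF imageI[OF qS, of M]] Mp linear_diff[OF \<open>linear M\<close>, of q p] by (simp add: w_def)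
    have Mqz: "norm (M q - b) \<le> BM * dist z q + norm (M z - b)"
    proof -
      have "M q - b = M (q - z) + (M z - b)" using linear_diff[OF \<open>linear M\<close>] by simp
      then have "norm (M q - b) \<le> norm (M (q - z)) + norm (M z - b)" by (metis norm_triangle_ineq)
      also have "norm (M (q - z)) \<le> BM * norm (q - z)" by (rule BM(2))
      finally show ?thesis by (simp add: dist_norm norm_minus_commute)
    qed
    have nw: "norm w \<le> Bg * norm (M q - b)"
      using Bg(2)[of "M (q - p)"] Mp linear_diff[OF \<open>linear M\<close>] by (simp add: w_def)
    show "\<exists>z'\<in>C. M z' = b \<and> dist z z' \<le> (1 + N * BM + N) * (infdist z C + norm (M z - b))"
    \<comment> \<open>If \<open>w\<close> vanishes, \<open>q\<close> already solves
      \<open>M q = b\<close>; otherwise division by \<open>norm w\<close> is possible.\<close>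
    proof (cases "w = 0")
      case True
      have "dist z q \<le> (1 + N * BM + N) * (infdist z C + norm (M z - b))"
        using q N BM by (simp add: algebra_simps)
      moreover have "M q = b" using Mw True linear_0[OF \<open>linear M\<close>] by simp
      ultimately show ?thesis using q by blast
    next
      case False
      \<comment> \<open>The point \<open>q'\<close> lies at distance \<open>e\<close> from
        \<open>p\<close> against \<open>w\<close>, so its residual is \<open>- (e / norm w)\<close>
        times that of \<open>q\<close>. The weight \<open>t\<close> solves
        \<open>t * (e / norm w) = 1 - t\<close>, which makes the residuals of \<open>q\<close> and
        \<open>q'\<close> cancel in \<open>z'\<close>.\<close>
      define t where "t = norm w / (norm w + e)"
      define q' where "q' = p - (e / norm w) *\<^sub>R w"
      have q': "q' \<in> C"
      proof -
        have "- (e / norm w) *\<^sub>R w \<in> S" using wS by (simp add: S_def span_scale span_neg)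
        then have "q' \<in> affine hull C" using affS by (force simp: q'_def)
        moreover have "q' \<in> cball p e" using e False by (simp add: q'_def dist_norm)
        ultimately show ?thesis using e by auto
      qed
      have nwe: "norm w + e > 0" using e by (simp add: add_nonneg_pos)
      have t: "0 \<le> t" "t \<le> 1" using e nwe by (auto simp: t_def divide_simps)
      define z' where "z' = (1 - t) *\<^sub>R q + t *\<^sub>R q'"
      have z': "z' \<in> C"
        using \<open>convex C\<close> q q' t by (auto simp: z'_def convex_alt)
      have te: "t * (e / norm w) = 1 - t"
        using nwe False by (simp add: t_def field_simps)
      have "M z' = (1 - t) *\<^sub>R M q + t *\<^sub>R (b - (e / norm w) *\<^sub>R M w)"
        using \<open>linear M\<close> Mp by (simp add: z'_def q'_def linear_add linear_diff linear_scale)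
      also have "\<dots> = (1 - t) *\<^sub>R M q + t *\<^sub>R b - (t * (e / norm w)) *\<^sub>R (M q - b)"
        by (simp add: Mw algebra_simps)
      also have "\<dots> = b" unfolding te by (simp add: algebra_simps)
      finally have Mz': "M z' = b" .
      have "dist q q' \<le> e + 2 * R"
        using dist_triangle[of q q' p] dpq e False by (simp add: q'_def dist_norm norm_minus_commute)
      \<comment> \<open>Dropping \<open>norm w\<close> from the denominator makes the displacement
        of \<open>q\<close> linear in the residual, with the factor \<open>N\<close>.\<close>
      moreover have "t \<le> norm w / e"
        using e nwe by (simp add: t_def frac_le)
      moreover have "dist q z' = t * dist q q'"
      proof -
        have "q - z' = t *\<^sub>R (q - q')" by (simp add: z'_def algebra_simps)
        then show ?thesis using t by (simp add: dist_norm)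
      qed
      ultimately have "dist q z' \<le> norm w / e * (e + 2 * R)"
        using t e R by (auto intro!: mult_mono simp del: times_divide_eq_left)
      also have "\<dots> \<le> (Bg * norm (M q - b)) / e * (e + 2 * R)"
        using nw e R by (intro mult_right_mono divide_right_mono) auto
      also have "\<dots> = N * norm (M q - b)" by (simp add: N_def)
      also have "\<dots> \<le> N * (BM * dist z q + norm (M z - b))"
        using Mqz N by (intro mult_left_mono) auto
      finally have "dist z z' \<le> dist z q + N * (BM * dist z q + norm (M z - b))"
        using dist_triangle[of z z' q] by linarith
      also have "\<dots> \<le> (1 + N * BM + N) * (dist z q + norm (M z - b))"
        using N BM by (simp add: algebra_simps)
      finally show ?thesis using z' Mz' q by auto
    qed
  qed
qed

text \<open>Squares the regularity bound and replaces the squared distance to \<open>C\<close> by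
  \<open>k * t\<close>. Later \<open>t\<close> is the pairing of a point with an optimal slack or an
  optimal primal solution; since \<kappa> is chosen before \<open>t\<close>, the growth constant is
  uniform over those solutions.\<close>

lemma quadratic_growth:
  fixes M :: "'a::euclidean_space \<Rightarrow> 'b::euclidean_space" and \<beta> k :: real
  assumes "closed C" and "convex C" and "linear M"
    and "p \<in> rel_interior C" and "M p = b" and "bounded Z" and "\<beta> > 0" and "k > 0"
  shows "\<exists>\<kappa>>0. \<forall>z\<in>Z. \<forall>t. (infdist z C)\<^sup>2 \<le> k * t \<longrightarrow>
    (\<exists>z'\<in>C. M z' = b \<and> \<kappa> * (dist z z')\<^sup>2 \<le> t + 1 / (2 * \<beta>) * (norm (M z - b))\<^sup>2)"
proof -
  obtain \<gamma> where \<gamma>: "\<gamma> > 0"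
    "\<And>z. z \<in> Z \<Longrightarrow> \<exists>z'\<in>C. M z' = b \<and> dist z z' \<le> \<gamma> * (infdist z C + norm (M z - b))"
    using bounded_linear_regularity[OF assms(1-6)] by blast
  \<comment> \<open>The factor \<open>2 * \<gamma>\<^sup>2\<close> comes from squaring a sum of two
    terms; \<open>k + 2 * \<beta>\<close> dominates both \<open>k\<close> and the inverse of the
    penalty weight.\<close>
  define G where "G = 2 * \<gamma>\<^sup>2 * (k + 2 * \<beta>)"
  have G: "G > 0" using \<gamma> assms(7,8) by (simp add: G_def)
  show ?thesis
  proof (intro exI[of _ "1 / G"] conjI ballI allI impI)
    show "1 / G > 0" using G by simp
    fix z t assume z: "z \<in> Z" and t: "(infdist z C)\<^sup>2 \<le> k * t"
    obtain z' where z': "z' \<in> C" "M z' = b" "dist z z' \<le> \<gamma> * (infdist z C + norm (M z - b))"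
      using \<gamma>(2)[OF z] by blast
    let ?d = "infdist z C" and ?e = "norm (M z - b)"
    \<comment> \<open>The sign of \<open>t\<close> is needed for the cross term
      \<open>2 * \<beta> * t\<close> when the product with \<open>k + 2 * \<beta>\<close> is
      expanded.\<close>
    have "0 \<le> k * t" using t order_trans[OF zero_le_power2] by blast
    then have t0: "t \<ge> 0" using \<open>k > 0\<close> by (simp add: zero_le_mult_iff)
    have "(dist z z')\<^sup>2 \<le> (\<gamma> * (?d + ?e))\<^sup>2" using z' by (simp add: power_mono)
    also have "\<dots> \<le> \<gamma>\<^sup>2 * (2 * (?d\<^sup>2 + ?e\<^sup>2))"
      unfolding power_mult_distrib
    proof (rule mult_left_mono)
      show "(?d + ?e)\<^sup>2 \<le> 2 * (?d\<^sup>2 + ?e\<^sup>2)"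
        using zero_le_power2[of "?d - ?e"] by (simp add: power2_eq_square algebra_simps)
    qed simp
    also have "\<dots> \<le> \<gamma>\<^sup>2 * (2 * (k * t + ?e\<^sup>2))" using t by (intro mult_left_mono) auto
    also have "\<dots> \<le> G * (t + 1 / (2 * \<beta>) * ?e\<^sup>2)"
    proof -
      have "k * t + ?e\<^sup>2 \<le> (k + 2 * \<beta>) * (t + 1 / (2 * \<beta>) * ?e\<^sup>2)"
        using t0 \<open>\<beta> > 0\<close> \<open>k > 0\<close> by (simp add: field_simps)
      then have "2 * \<gamma>\<^sup>2 * (k * t + ?e\<^sup>2) \<le> 2 * \<gamma>\<^sup>2 * ((k + 2 * \<beta>) * (t + 1 / (2 * \<beta>) * ?e\<^sup>2))"
        by (intro mult_left_mono) auto
      then show ?thesis by (simp only: G_def mult_ac)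
    qed
    finally show "\<exists>z'\<in>C. M z' = b \<and> 1 / G * (dist z z')\<^sup>2 \<le> t + 1 / (2 * \<beta>) * ?e\<^sup>2"
      using z' G by (intro bexI[of _ z']) (auto simp: field_simps)
  qed
qed

section \<open>Relative interiors, dual cones and faces\<close>

text \<open>Reflecting \<open>s0\<close> through \<open>s\<close> stays in the affine hull and
  doubles the distance to \<open>s0\<close>, so half the radius of a relative ball suffices.
  Membership of the reflection is what later compares pairings with \<open>s0\<close> and with
  \<open>s\<close> up to a factor 2.\<close>

lemma rel_interior_reflection:
  fixes F :: "'a::euclidean_space set"
  assumes "s0 \<in> rel_interior F"
  shows "\<exists>\<delta>>0. \<forall>s\<in>F. dist s s0 \<le> \<delta> \<longrightarrow> 2 *\<^sub>R s - s0 \<in> F"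
proof -
  obtain e where e: "e > 0" "cball s0 e \<inter> affine hull F \<subseteq> F" and s0: "s0 \<in> F"
    using assms by (auto simp: mem_rel_interior_cball)
  show ?thesis
  proof (intro exI[of _ "e / 2"] conjI ballI impI)
    fix s assume s: "s \<in> F" "dist s s0 \<le> e / 2"
    have "2 *\<^sub>R s + (- 1) *\<^sub>R s0 \<in> affine hull F"
      using s s0 by (intro mem_affine[OF affine_affine_hull]) (auto intro: hull_inc)
    moreover have "s0 - (2 *\<^sub>R s - s0) = 2 *\<^sub>R (s0 - s)" by (simp add: algebra_simps scaleR_2)
    then have "2 *\<^sub>R s - s0 \<in> cball s0 e"
      using s(2) by (simp add: dist_norm norm_minus_commute)
    ultimately show "2 *\<^sub>R s - s0 \<in> F" using e by auto
  qed (use e in simp)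
qed

lemma closed_dual_cone: "closed (dual_cone K)"
proof -
  have "dual_cone K = (\<Inter>x\<in>K. {s. 0 \<le> s \<bullet> x})" by (auto simp: dual_cone_def)
  then show ?thesis by (auto intro!: closed_Collect_le continuous_intros)
qed

lemma convex_dual_cone: "convex (dual_cone K)"
  by (auto simp: convex_def dual_cone_def inner_add_left)

lemma cone_face_eq_Int: "cone_face K s = K \<inter> {x. s \<bullet> x = 0}"
  by (auto simp: cone_face_def)

lemma closed_cone_face: "closed K \<Longrightarrow> closed (cone_face K s)"
  unfolding cone_face_eq_Int by (intro closed_Int closed_hyperplane)

lemma convex_cone_face: "convex K \<Longrightarrow> convex (cone_face K s)"
  unfolding cone_face_eq_Int by (intro convex_Int convex_hyperplane)

section \<open>Optimal sets and optimal values\<close>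

lemma slack_inner:
  fixes A :: "'e::euclidean_space \<Rightarrow> 'f::euclidean_space"
  assumes "linear A"
  shows "(c + adjoint A y) \<bullet> x = c \<bullet> x + y \<bullet> A x"
  using adjoint_works[OF assms, of x y]
  by (simp add: inner_add_left inner_commute[of "adjoint A y"] inner_commute[of y])

text \<open>On the feasible set, pairing with the slack of \<open>y0\<close> adds the constant
  \<open>y0 \<bullet> b\<close> to the objective. By complementarity the pairing vanishes at
  \<open>x0\<close>, so it equals the optimality gap.\<close>

lemma primal_optimal_eq:
  fixes A :: "'e::euclidean_space \<Rightarrow> 'f::euclidean_space"
  assumes "linear A" and "strictly_complementary A b c K x0 y0"
  shows "primal_optimal A b c K = {x \<in> cone_face K (c + adjoint A y0). A x = b}"
proof -
  have x0: "A x0 = b" "x0 \<in> K" and s0: "c + adjoint A y0 \<in> dual_cone K"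
    and opt: "\<And>x. A x = b \<Longrightarrow> x \<in> K \<Longrightarrow> c \<bullet> x0 \<le> c \<bullet> x"
    and "c \<bullet> x0 = - (y0 \<bullet> b)"
    using assms(2) slack_inner[OF assms(1), of c y0 x0]
    by (auto simp: strictly_complementary_def primal_optimal_def dual_optimal_def
        is_arg_min_linorder is_arg_max_linorder inner_commute)
  then have "x \<in> primal_optimal A b c K \<longleftrightarrow> x \<in> cone_face K (c + adjoint A y0) \<and> A x = b" for x
    unfolding primal_optimal_def is_arg_min_linorder cone_face_def mem_Collect_eq
      slack_inner[OF assms(1)]
    by (smt (verit))
  then show ?thesis by blast
qed

text \<open>Since \<open>A x0 = b\<close>, the pairing of \<open>x0\<close> with the slack of
  \<open>y\<close> equals \<open>b \<bullet> y - b \<bullet> y0\<close>, the dual optimality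
  gap.\<close>

lemma dual_optimal_eq:
  fixes A :: "'e::euclidean_space \<Rightarrow> 'f::euclidean_space"
  assumes "linear A" and "strictly_complementary A b c K x0 y0"
  shows "dual_optimal A b c K = {y. c + adjoint A y \<in> cone_face (dual_cone K) x0}"
proof -
  have x0: "A x0 = b" and s0: "c + adjoint A y0 \<in> dual_cone K"
    and opt: "\<And>y. c + adjoint A y \<in> dual_cone K \<Longrightarrow> - (b \<bullet> y) \<le> - (b \<bullet> y0)"
    and "c \<bullet> x0 = - (b \<bullet> y0)"
    using assms(2) slack_inner[OF assms(1), of c y0 x0]
    by (auto simp: strictly_complementary_def primal_optimal_def dual_optimal_def
        is_arg_min_linorder is_arg_max_linorder inner_commute)
  moreover have "x0 \<bullet> (c + adjoint A y) = c \<bullet> x0 + b \<bullet> y" for y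
    using slack_inner[OF assms(1), of c y x0] x0 by (simp add: inner_commute)
  ultimately have "y \<in> dual_optimal A b c K \<longleftrightarrow> c + adjoint A y \<in> cone_face (dual_cone K) x0" for y
    unfolding dual_optimal_def is_arg_max_linorder cone_face_def mem_Collect_eq
    by (smt (verit))
  then show ?thesis by blast
qed

text \<open>Every primal solution is orthogonal to the slack of \<open>y0\<close>, and
  \<open>x0\<close> to every optimal slack; both optimal values thus reduce to those of the
  reference pair, where the duality gap is zero.\<close>

lemma optimal_pair_value:
  fixes A :: "'e::euclidean_space \<Rightarrow> 'f::euclidean_space"
  assumes "linear A" and "strictly_complementary A b c K x0 y0"
    and "xs \<in> primal_optimal A b c K" and "ys \<in> dual_optimal A b c K"
  shows "c \<bullet> xs = - (b \<bullet> ys)"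
proof -
  have "A x0 = b" "x0 \<bullet> (c + adjoint A y0) = 0"
    using assms(2) by (auto simp: strictly_complementary_def primal_optimal_def is_arg_min_linorder)
  then have "c \<bullet> x0 + b \<bullet> y0 = 0"
    using slack_inner[OF assms(1), of c y0 x0] by (simp add: inner_commute)
  moreover have "c \<bullet> xs + b \<bullet> y0 = 0"
    using assms(3) slack_inner[OF assms(1), of c y0 xs]
    by (simp add: primal_optimal_eq[OF assms(1,2)] cone_face_def inner_commute)
  moreover have "c \<bullet> x0 + b \<bullet> ys = 0"
    using assms(4) slack_inner[OF assms(1), of c ys x0] \<open>A x0 = b\<close>
    by (simp add: dual_optimal_eq[OF assms(1,2)] cone_face_def inner_commute)
  ultimately show ?thesis by linarith
qed

section \<open>Lagrangian gaps\<close>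

text \<open>At the reference point the indicators and the residual vanish, leaving the finite value
  \<open>- (b \<bullet> ys)\<close>; subtracting it turns the linear terms into the pairing of
  \<open>x\<close> with the slack of \<open>ys\<close>.\<close>

lemma primal_lagrangian_gap:
  fixes A :: "'e::euclidean_space \<Rightarrow> 'f::euclidean_space"
  assumes "linear A" and "strictly_complementary A b c K x0 y0"
    and xs: "xs \<in> primal_optimal A b c K" and ys: "ys \<in> dual_optimal A b c K"
  shows "primal_lagrangian A b c K \<beta> x u ys - primal_lagrangian A b c K \<beta> xs b ys =
    (if x \<in> K \<and> u = b
     then ereal ((c + adjoint A ys) \<bullet> x + 1 / (2 * \<beta>) * (norm (A x - b))\<^sup>2) else \<infinity>)"
proof -
  have "A xs = b" "xs \<in> K" using xs by (auto simp: primal_optimal_def is_arg_min_linorder)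
  then have L: "primal_lagrangian A b c K \<beta> xs b ys = ereal (- (b \<bullet> ys))"
    using optimal_pair_value[OF assms] by (simp add: primal_lagrangian_def indicator_fun_def)
  show ?thesis
    unfolding L
    by (auto simp: primal_lagrangian_def indicator_fun_def slack_inner[OF assms(1)]
        inner_diff_right inner_commute[of b])
qed

text \<open>The term \<open>b \<bullet> y\<close> cancels against
  \<open>xs \<bullet> adjoint A y\<close>, and the reference value \<open>b \<bullet> ys\<close>
  equals \<open>- (c \<bullet> xs)\<close>, which completes \<open>- (xs \<bullet> v)\<close> to a
  pairing with \<open>c - v\<close>.\<close>

lemma dual_lagrangian_gap:
  fixes A :: "'e::euclidean_space \<Rightarrow> 'f::euclidean_space"
  assumes "linear A" and "strictly_complementary A b c K x0 y0"
    and xs: "xs \<in> primal_optimal A b c K" and ys: "ys \<in> dual_optimal A b c K"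
  shows "dual_lagrangian A b c K \<beta> y v xs - dual_lagrangian A b c K \<beta> ys (- adjoint A ys) xs =
    (if c - v \<in> dual_cone K
     then ereal (xs \<bullet> (c - v) + 1 / (2 * \<beta>) * (norm (adjoint A y + v))\<^sup>2) else \<infinity>)"
proof -
  have Axs: "A xs = b" using xs by (auto simp: primal_optimal_def is_arg_min_linorder)
  have "c + adjoint A ys \<in> dual_cone K"
    using ys by (auto simp: dual_optimal_def is_arg_max_linorder)
  then have L: "dual_lagrangian A b c K \<beta> ys (- adjoint A ys) xs = ereal (b \<bullet> ys)"
    by (simp add: dual_lagrangian_def indicator_fun_def)
  have "xs \<bullet> adjoint A y = b \<bullet> y"
    using adjoint_works[OF assms(1), of xs y] Axs by simp
  then show ?thesis
    unfolding L using optimal_pair_value[OF assms]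
    by (auto simp: dual_lagrangian_def indicator_fun_def inner_diff_right inner_commute[of c])
qed

section \<open>Growth of both Lagrangians near the strictly complementary pair\<close>

theorem mainTheorem3:
  fixes A :: "'e::euclidean_space \<Rightarrow> 'f::euclidean_space"
    and b :: 'f and c :: 'e and K :: "'e set"
    and x0 :: 'e and y0 :: 'f and \<beta> :: real
  assumes "linear A"
    and "closed K" and "convex_cone K"
    and "strictly_complementary A b c K x0 y0"
    and "admits_qfv K (dual_cone K) (cone_face K (c + adjoint A y0))"
    and "admits_qfv (dual_cone K) K (cone_face (dual_cone K) x0)"
    and "\<beta> > 0"
  shows "\<exists>r>0. \<forall>B :: ('e \<times> 'e \<times> 'f \<times> 'f) set. compact B \<longrightarrow>
    (\<exists>\<kappa>\<^sub>1>0. \<exists>\<kappa>\<^sub>2>0. \<forall>(x, v, u, y)\<in>B.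
      \<forall>(xs, ys)\<in>(primal_optimal A b c K \<times> dual_optimal A b c K) \<inter> cball (x0, y0) r.
        primal_lagrangian A b c K \<beta> x u ys - primal_lagrangian A b c K \<beta> xs b ys
          \<ge> ereal (\<kappa>\<^sub>1 * (infdist (x, u) ((\<lambda>x. (x, A x)) ` primal_optimal A b c K))\<^sup>2) \<and>
        dual_lagrangian A b c K \<beta> y v xs - dual_lagrangian A b c K \<beta> ys (- adjoint A ys) xs
          \<ge> ereal (\<kappa>\<^sub>2 * (infdist (y, v) ((\<lambda>y. (y, - adjoint A y)) ` dual_optimal A b c K))\<^sup>2))"
proof -
  note lin = \<open>linear A\<close> and sc = \<open>strictly_complementary A b c K x0 y0\<close>
  define s0 where "s0 = c + adjoint A y0"
  have "convex K" using \<open>convex_cone K\<close> by (simp add: convex_cone_def)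
  have linadj: "linear (adjoint A)" by (rule adjoint_linear[OF lin])
  have s0: "s0 \<in> dual_cone K" "s0 \<in> rel_interior (cone_face (dual_cone K) x0)"
    and x0: "A x0 = b" "x0 \<in> K" "x0 \<in> rel_interior (cone_face K s0)"
    using sc by (auto simp: s0_def strictly_complementary_def primal_optimal_def dual_optimal_def
        is_arg_min_linorder is_arg_max_linorder)
  note P_eq = primal_optimal_eq[OF lin sc, folded s0_def] and D_eq = dual_optimal_eq[OF lin sc]
  have qP: "qfv_relative K s0" and qD: "qfv_relative (dual_cone K) x0"
    using assms(5,6) s0 x0 by (auto simp: admits_qfv_def s0_def)
  obtain \<delta>1 where \<delta>1: "\<delta>1 > 0"
    "\<And>x. x \<in> cone_face K s0 \<Longrightarrow> dist x x0 \<le> \<delta>1 \<Longrightarrow> 2 *\<^sub>R x - x0 \<in> cone_face K s0"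
    using rel_interior_reflection[OF x0(3)] by blast
  obtain \<delta>2 where \<delta>2: "\<delta>2 > 0"
    "\<And>s. s \<in> cone_face (dual_cone K) x0 \<Longrightarrow> dist s s0 \<le> \<delta>2 \<Longrightarrow>
      2 *\<^sub>R s - s0 \<in> cone_face (dual_cone K) x0"
    using rel_interior_reflection[OF s0(2)] by blast
  obtain BA where BA: "BA > 0" "\<And>y. norm (adjoint A y) \<le> BA * norm y"
    using linear_bounded_pos[OF linadj] by blast
  \<comment> \<open>The radius \<open>\<delta>1\<close> applies to \<open>xs\<close> directly;
    \<open>\<delta>2\<close> applies to slacks, whose distance to \<open>s0\<close> is at most
    \<open>BA\<close> times that of \<open>ys\<close> to \<open>y0\<close>.\<close>
  define r where "r = min \<delta>1 (\<delta>2 / BA)"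
  have r: "r > 0" using \<delta>1 \<delta>2 BA by (simp add: r_def)
  have near_x: "x0 \<bullet> s \<le> 2 * (xs \<bullet> s)"
    if "xs \<in> primal_optimal A b c K" "dist xs x0 \<le> r" "s \<in> dual_cone K" for xs s
  proof -
    have "2 *\<^sub>R xs - x0 \<in> K" using \<delta>1(2)[of xs] that by (auto simp: P_eq r_def cone_face_def)
    then have "0 \<le> s \<bullet> (2 *\<^sub>R xs - x0)" using that by (auto simp: dual_cone_def)
    then show ?thesis by (simp add: inner_diff_right inner_commute)
  qed
  have near_s: "s0 \<bullet> x \<le> 2 * ((c + adjoint A ys) \<bullet> x)"
    if "ys \<in> dual_optimal A b c K" "dist ys y0 \<le> r" "x \<in> K" for ys x
  proof -
    have "dist (c + adjoint A ys) s0 = norm (adjoint A (ys - y0))"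
      by (simp add: s0_def dist_norm linear_diff[OF linadj])
    also have "\<dots> \<le> BA * (\<delta>2 / BA)"
      using BA(2)[of "ys - y0"] that(2) BA(1)
      by (smt (verit, best) dist_norm mult_left_mono r_def)
    finally have "dist (c + adjoint A ys) s0 \<le> \<delta>2" using BA by simp
    then have "2 *\<^sub>R (c + adjoint A ys) - s0 \<in> dual_cone K"
      using \<delta>2(2)[of "c + adjoint A ys"] that by (auto simp: D_eq cone_face_def)
    then have "0 \<le> (2 *\<^sub>R (c + adjoint A ys) - s0) \<bullet> x" using that by (auto simp: dual_cone_def)
    then show ?thesis by (simp only: inner_diff_left inner_scaleR_left)
  qed
  show ?thesis
  proof (rule exI[of _ r], intro conjI allI impI r)
    fix B :: "('e \<times> 'e \<times> 'f \<times> 'f) set" assume B: "compact B"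
    \<comment> \<open>The substitution of \<open>c - v\<close> for \<open>v\<close> expresses the
      dual Lagrangian in slack coordinates. \<open>BS\<close> serves the facial violation bound,
      \<open>BZ\<close> the regularity bound, which also involves \<open>y\<close>.\<close>
    define BX where "BX = (\<lambda>(x, v, u, y). x) ` B"
    define BS where "BS = (\<lambda>(x, v, u, y). c - v) ` B"
    define BZ where "BZ = (\<lambda>(x, v, u, y). (y, c - v)) ` B"
    have cpt: "compact BX" "compact BS" "compact BZ"
      unfolding BX_def BS_def BZ_def split_def
      by (intro compact_continuous_image B continuous_intros)+
    obtain k1 where k1: "k1 > 0" "\<And>x. x \<in> BX \<Longrightarrow> x \<in> K \<Longrightarrow> (infdist x (cone_face K s0))\<^sup>2 \<le> k1 * (s0 \<bullet> x)"
      using qP cpt(1) unfolding qfv_relative_def by blast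
    obtain k2 where k2: "k2 > 0" "\<And>s. s \<in> BS \<Longrightarrow> s \<in> dual_cone K \<Longrightarrow>
        (infdist s (cone_face (dual_cone K) x0))\<^sup>2 \<le> k2 * (x0 \<bullet> s)"
      using qD cpt(2) unfolding qfv_relative_def by blast
    \<comment> \<open>The factor 2 in \<open>2 * k1\<close> absorbs the loss in
      \<open>near_s\<close>.\<close>
    obtain \<kappa>1 where \<kappa>1: "\<kappa>1 > 0"
      "\<And>x t. x \<in> BX \<Longrightarrow> (infdist x (cone_face K s0))\<^sup>2 \<le> (2 * k1) * t \<Longrightarrow>
        \<exists>x'\<in>cone_face K s0. A x' = b \<and> \<kappa>1 * (dist x x')\<^sup>2 \<le> t + 1 / (2 * \<beta>) * (norm (A x - b))\<^sup>2"
      using quadratic_growth[OF closed_cone_face[OF \<open>closed K\<close>] convex_cone_face[OF \<open>convex K\<close>] lin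
          x0(3,1) compact_imp_bounded[OF cpt(1)] \<open>\<beta> > 0\<close>, of "2 * k1"] k1(1) by auto
    \<comment> \<open>Points of \<open>C\<close> with \<open>M z = c\<close> are exactly the pairs
      of a dual solution and its slack, and \<open>M (y, c - v) - c\<close> is, up to sign, the
      penalized residual \<open>adjoint A y + v\<close>.\<close>
    define C where "C = (UNIV :: 'f set) \<times> cone_face (dual_cone K) x0"
    define M where "M = (\<lambda>z :: 'f \<times> 'e. snd z - adjoint A (fst z))"
    have "linear M"
      unfolding M_def
      by (intro linear_compose_sub linear_snd linear_compose[OF linear_fst linadj, unfolded o_def])
    moreover have "closed C" "convex C"
      unfolding C_def
      by (intro closed_Times convex_Times closed_cone_face convex_cone_face closed_dual_cone
          convex_dual_cone closed_UNIV convex_UNIV)+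
    moreover have "(y0, s0) \<in> rel_interior C"
      using s0(2) by (simp add: C_def rel_interior_Times convex_cone_face convex_dual_cone)
    moreover have "M (y0, s0) = c" by (simp add: M_def s0_def)
    ultimately obtain \<kappa>2 where \<kappa>2: "\<kappa>2 > 0"
      "\<And>z t. z \<in> BZ \<Longrightarrow> (infdist z C)\<^sup>2 \<le> (2 * k2) * t \<Longrightarrow>
        \<exists>z'\<in>C. M z' = c \<and> \<kappa>2 * (dist z z')\<^sup>2 \<le> t + 1 / (2 * \<beta>) * (norm (M z - c))\<^sup>2"
      using quadratic_growth[of C M "(y0, s0)" c BZ \<beta> "2 * k2"]
        compact_imp_bounded[OF cpt(3)] \<open>\<beta> > 0\<close> k2(1) by auto
    have primal: "primal_lagrangian A b c K \<beta> x u ys - primal_lagrangian A b c K \<beta> xs b ys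
          \<ge> ereal (\<kappa>1 * (infdist (x, u) ((\<lambda>x. (x, A x)) ` primal_optimal A b c K))\<^sup>2)"
      if "(x, v, u, y) \<in> B" and xs: "xs \<in> primal_optimal A b c K" and ys: "ys \<in> dual_optimal A b c K"
        and d: "dist ys y0 \<le> r" for x v u y xs ys
    proof (cases "x \<in> K \<and> u = b")
      case True
      have x: "x \<in> BX" using that(1) by (force simp: BX_def)
      let ?t = "(c + adjoint A ys) \<bullet> x"
      have "(infdist x (cone_face K s0))\<^sup>2 \<le> k1 * (s0 \<bullet> x)" using k1(2) x True by blast
      also have "\<dots> \<le> k1 * (2 * ?t)"
        using near_s[OF ys d, of x] True k1(1) by (intro mult_left_mono) auto
      finally obtain x' where x': "x' \<in> cone_face K s0" "A x' = b"
        "\<kappa>1 * (dist x x')\<^sup>2 \<le> ?t + 1 / (2 * \<beta>) * (norm (A x - b))\<^sup>2"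
        using \<kappa>1(2)[OF x, of ?t] by (auto simp: mult_ac)
      have "infdist (x, u) ((\<lambda>x. (x, A x)) ` primal_optimal A b c K) \<le> dist (x, u) (x', A x')"
        using x' by (intro infdist_le) (auto simp: P_eq)
      \<comment> \<open>Both second components equal \<open>b\<close>, so only the distance between
        the first ones remains.\<close>
      also have "\<dots> = dist x x'" using True x' by (simp add: dist_Pair_Pair)
      finally have "\<kappa>1 * (infdist (x, u) ((\<lambda>x. (x, A x)) ` primal_optimal A b c K))\<^sup>2
          \<le> \<kappa>1 * (dist x x')\<^sup>2"
        using \<kappa>1(1) by (simp add: power_mono infdist_nonneg)
      also note x'(3)
      finally show ?thesis using True by (simp add: primal_lagrangian_gap[OF lin sc xs ys])
    qed (simp add: primal_lagrangian_gap[OF lin sc xs ys] del: de_Morgan_conj)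
    have dual: "dual_lagrangian A b c K \<beta> y v xs - dual_lagrangian A b c K \<beta> ys (- adjoint A ys) xs
          \<ge> ereal (\<kappa>2 * (infdist (y, v) ((\<lambda>y. (y, - adjoint A y)) ` dual_optimal A b c K))\<^sup>2)"
      if "(x, v, u, y) \<in> B" and xs: "xs \<in> primal_optimal A b c K" and ys: "ys \<in> dual_optimal A b c K"
        and d: "dist xs x0 \<le> r" for x v u y xs ys
    proof (cases "c - v \<in> dual_cone K")
      case True
      have s: "c - v \<in> BS" and z: "(y, c - v) \<in> BZ"
        using that(1) by (force simp: BS_def BZ_def)+
      let ?t = "xs \<bullet> (c - v)"
      have "cone_face (dual_cone K) x0 \<noteq> {}" using s0(2) rel_interior_subset by blast
      then obtain q where q: "q \<in> cone_face (dual_cone K) x0"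
        "infdist (c - v) (cone_face (dual_cone K) x0) = dist (c - v) q"
        using infdist_attains_inf closed_cone_face[OF closed_dual_cone] by metis
      \<comment> \<open>Because \<open>y\<close> is unrestricted in \<open>C\<close>, the candidate
        \<open>(y, q)\<close> changes the slack component only.\<close>
      have "infdist (y, c - v) C \<le> dist (y, c - v) (y, q)"
        using q by (intro infdist_le) (auto simp: C_def)
      then have "(infdist (y, c - v) C)\<^sup>2 \<le> (infdist (c - v) (cone_face (dual_cone K) x0))\<^sup>2"
        using q by (simp add: dist_Pair_Pair power_mono infdist_nonneg)
      also have "\<dots> \<le> k2 * (x0 \<bullet> (c - v))" using k2(2) s True by blast
      also have "\<dots> \<le> k2 * (2 * ?t)"
        using near_x[OF xs d True] k2(1) by (intro mult_left_mono) auto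
      finally obtain z' where z': "z' \<in> C" "M z' = c"
        "\<kappa>2 * (dist (y, c - v) z')\<^sup>2 \<le> ?t + 1 / (2 * \<beta>) * (norm (M (y, c - v) - c))\<^sup>2"
        using \<kappa>2(2)[OF z, of ?t] by (auto simp: mult_ac)
      obtain y' s' where z'_eq: "z' = (y', s')" by (cases z')
      have s': "s' = c + adjoint A y'" using z'(2) by (simp add: M_def z'_eq algebra_simps)
      have "infdist (y, v) ((\<lambda>y. (y, - adjoint A y)) ` dual_optimal A b c K)
          \<le> dist (y, v) (y', - adjoint A y')"
        using z'(1) s' by (intro infdist_le) (auto simp: D_eq C_def z'_eq)
      \<comment> \<open>The map from \<open>v\<close> to \<open>c - v\<close> is an isometry, so the
        estimate transfers back to the original variables.\<close>
      also have "\<dots> = dist (y, c - v) z'"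
      proof -
        have "dist v (- adjoint A y') = dist (c - v) s'"
          using norm_minus_cancel[of "v + adjoint A y'"] by (simp add: s' dist_norm)
        then show ?thesis by (simp add: dist_Pair_Pair z'_eq)
      qed
      finally have "\<kappa>2 * (infdist (y, v) ((\<lambda>y. (y, - adjoint A y)) ` dual_optimal A b c K))\<^sup>2
          \<le> \<kappa>2 * (dist (y, c - v) z')\<^sup>2"
        using \<kappa>2(1) by (simp add: power_mono infdist_nonneg)
      also note z'(3)
      also have "norm (M (y, c - v) - c) = norm (adjoint A y + v)"
        using norm_minus_cancel[of "v + adjoint A y"] by (simp add: M_def add.commute)
      finally show ?thesis using True by (simp add: dual_lagrangian_gap[OF lin sc xs ys])
    qed (simp add: dual_lagrangian_gap[OF lin sc xs ys])
    have near: "dist xs x0 \<le> r" "dist ys y0 \<le> r" if "(xs, ys) \<in> cball (x0, y0) r" for xs ys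
      using that dist_fst_le[of "(x0, y0)" "(xs, ys)"] dist_snd_le[of "(x0, y0)" "(xs, ys)"]
      by (auto simp: dist_commute)
    show "\<exists>\<kappa>\<^sub>1>0. \<exists>\<kappa>\<^sub>2>0. \<forall>(x, v, u, y)\<in>B.
      \<forall>(xs, ys)\<in>(primal_optimal A b c K \<times> dual_optimal A b c K) \<inter> cball (x0, y0) r.
        primal_lagrangian A b c K \<beta> x u ys - primal_lagrangian A b c K \<beta> xs b ys
          \<ge> ereal (\<kappa>\<^sub>1 * (infdist (x, u) ((\<lambda>x. (x, A x)) ` primal_optimal A b c K))\<^sup>2) \<and>
        dual_lagrangian A b c K \<beta> y v xs - dual_lagrangian A b c K \<beta> ys (- adjoint A ys) xs
          \<ge> ereal (\<kappa>\<^sub>2 * (infdist (y, v) ((\<lambda>y. (y, - adjoint A y)) ` dual_optimal A b c K))\<^sup>2)"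
    proof (rule exI[of _ \<kappa>1], rule conjI[OF \<kappa>1(1)], rule exI[of _ \<kappa>2], rule conjI[OF \<kappa>2(1)],
        clarify, rule conjI)
      fix x v u y xs ys
      assume z: "(x, v, u, y) \<in> B" "xs \<in> primal_optimal A b c K" "ys \<in> dual_optimal A b c K"
        and d: "(xs, ys) \<in> cball (x0, y0) r"
      show "primal_lagrangian A b c K \<beta> x u ys - primal_lagrangian A b c K \<beta> xs b ys
          \<ge> ereal (\<kappa>1 * (infdist (x, u) ((\<lambda>x. (x, A x)) ` primal_optimal A b c K))\<^sup>2)"
        by (rule primal[OF z near(2)[OF d]])
      show "dual_lagrangian A b c K \<beta> y v xs - dual_lagrangian A b c K \<beta> ys (- adjoint A ys) xs
          \<ge> ereal (\<kappa>2 * (infdist (y, v) ((\<lambda>y. (y, - adjoint A y)) ` dual_optimal A b c K))\<^sup>2)"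
        by (rule dual[OF z near(1)[OF d]])
    qed
  qed
qed

end
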